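(* Let $\mathbb{P}, \mathbb{Q}$ be forcing notions, $\iota \colon \mathbb{P} \to \mathbb{Q}$ a complete embedding and $Q \subseteq \mathbb{P}$. Then $\mathrm{int}^{\mathbb{P}}(Q) = \mathrm{int}^{\mathbb{Q}}(\iota[Q])$. As a consequence, for every $R \subseteq \mathbb{Q}$, $\mathrm{int}^{\mathbb{Q}}(R) \leq \mathrm{int}^{\mathbb{P}}(\iota^{-1}[R])$.
   Context: A forcing notion is a nonempty preordered set $(\mathbb{P}, \leq)$; two elements are compatible if they have a common lower bound. A complete embedding $\iota \colon \mathbb{P} \to \mathbb{Q}$ is a map that preserves $\leq$, preserves incompatibility, and is such that every $q \in \mathbb{Q}$ has a reduction $r \in \mathbb{P}$, i.e. $\iota(r')$ is compatible with $q$ for every $r' \leq r$ in $\mathbb{P}$ (equivalently, it preserves order, incompatibility and maximal antichains). For $\bar{q} = \langle q_i \colon i < n\rangle \in {}^{n}\mathbb{P}$ (a function from $n=\{0,\dots,n-1\}$ to $\mathbb{P}$), $$i_{\ast}^{\mathbb{P}}(\bar{q}) := \max\{ |F| \colon F \subseteq n \text{ and } \{q_i \colon i \in F\} \text{ has a lower bound in } \mathbb{P}\}.$$ The intersection number of $Q\subseteq \mathbb{P}$ in $\mathbb{P}$ is $$\mathrm{int}^{\mathbb{P}}(Q) := \inf\left\{ \frac{i_{\ast}^{\mathbb{P}}(\bar{q})}{n} \colon \bar{q} \in {}^{n}Q,\ n \in \omega \setminus \{0\} \right\},$$ with the usual convention $\inf \emptyset = +\infty$ (so $\mathrm{int}^{\mathbb{P}}(\emptyset)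 = +\infty$). *)

theory Defs
  imports Complex_Main "HOL-Library.FuncSet" "HOL-Library.Extended_Real"
begin

text \<open>
  A forcing notion is given by its carrier and its order relation;
  \<^term>\<open>(p, q) \<in> le\<close> reads as: \<open>p\<close> is below (stronger than or equal to) \<open>q\<close>.
\<close>

definition forcing_notion :: "'a set \<Rightarrow> 'a rel \<Rightarrow> bool" where
  "forcing_notion P le \<longleftrightarrow> P \<noteq> {} \<and> preorder_on P le"

definition has_lower_bound :: "'a set \<Rightarrow> 'a rel \<Rightarrow> 'a set \<Rightarrow> bool" where
  "has_lower_bound P le X \<longleftrightarrow> (\<exists>p\<in>P. \<forall>x\<in>X. (p, x) \<in> le)"

definition compat :: "'a set \<Rightarrow> 'a rel \<Rightarrow> 'a \<Rightarrow> 'a \<Rightarrow> bool" where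
  "compat P le p q \<longleftrightarrow> has_lower_bound P le {p, q}"

definition is_reduction ::
    "'a set \<Rightarrow> 'a rel \<Rightarrow> 'b set \<Rightarrow> 'b rel \<Rightarrow> ('a \<Rightarrow> 'b) \<Rightarrow> 'b \<Rightarrow> 'a \<Rightarrow> bool" where
  "is_reduction P leP Q leQ \<iota> q r \<longleftrightarrow>
     r \<in> P \<and> (\<forall>r'\<in>P. (r', r) \<in> leP \<longrightarrow> compat Q leQ (\<iota> r') q)"

definition complete_embedding ::
    "'a set \<Rightarrow> 'a rel \<Rightarrow> 'b set \<Rightarrow> 'b rel \<Rightarrow> ('a \<Rightarrow> 'b) \<Rightarrow> bool" where
  "complete_embedding P leP Q leQ \<iota> \<longleftrightarrow>
     \<iota> \<in> P \<rightarrow> Q \<and>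
     (\<forall>p\<in>P. \<forall>p'\<in>P. (p, p') \<in> leP \<longrightarrow> (\<iota> p, \<iota> p') \<in> leQ) \<and>
     (\<forall>p\<in>P. \<forall>p'\<in>P. \<not> compat P leP p p' \<longrightarrow> \<not> compat Q leQ (\<iota> p) (\<iota> p')) \<and>
     (\<forall>q\<in>Q. \<exists>r. is_reduction P leP Q leQ \<iota> q r)"

text \<open>
  The set under \<^const>\<open>Max\<close> is finite, and it contains \<open>0\<close> (take \<open>F\<close> empty)
  because forcing notions are nonempty.
\<close>

definition i_star :: "'a set \<Rightarrow> 'a rel \<Rightarrow> nat \<Rightarrow> (nat \<Rightarrow> 'a) \<Rightarrow> nat" where
  "i_star P le n q = Max {card F | F. F \<subseteq> {..<n} \<and> has_lower_bound P le (q ` F)}"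

text \<open>
  The value is an extended real, so that the infimum of the empty set is \<open>\<infinity>\<close>,
  i.e. \<open>intersection_number P le {} = \<infinity>\<close>.
\<close>

definition intersection_number :: "'a set \<Rightarrow> 'a rel \<Rightarrow> 'a set \<Rightarrow> ereal" where
  "intersection_number P le A =
     Inf {ereal (real (i_star P le n q) / real n) | n q. n \<noteq> 0 \<and> q \<in> {..<n} \<rightarrow>\<^sub>E A}"

end

theory Submission
  imports Defs
begin

text \<open>
  A finite set has a lower bound in the domain of a complete embedding if and only if its image
  has one in the codomain (\<open>has_lower_bound_image_iff\<close>).  One direction is preservation of order.
  For the other, let \<open>q\<close> be a lower bound of the image and \<open>r\<close> a reduction of \<open>q\<close>.  Every element
  below \<open>r\<close> is compatible with every member of the finite set: its image is compatible with \<open>q\<close>,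
  hence with the image of the member, and incompatibility is preserved.  Hence \<open>r\<close> can be
  strengthened finitely often, once for each member, and it ends below all of them.

  Therefore composition with the embedding does not change \<^const>\<open>i_star\<close>.  Since every tuple in the
  image of \<open>A\<close> lifts to a tuple in \<open>A\<close>, the two infima range over the same ratios.  The inequality
  for preimages follows because the image of the preimage of \<open>R\<close> lies in \<open>R\<close>, and an infimum over
  fewer tuples is no smaller.
\<close>

text \<open>
  The statement is about every \<open>s\<close> below the reduction, not the reduction alone, so that it can be
  applied again after each strengthening step.
\<close>

lemma compat_below_reduction:
  assumes "trans leQ" "complete_embedding P leP Q leQ \<iota>"
    and "is_reduction P leP Q leQ \<iota> q r" "s \<in> P" "(s, r) \<in> leP"
    and "x \<in> P" "(q, \<iota> x) \<in> leQ"
  shows "compat P leP s x"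
proof -
  have "compat Q leQ (\<iota> s) q"
    using assms(3-5) unfolding is_reduction_def by blast
  then have "compat Q leQ (\<iota> s) (\<iota> x)"
    using assms(1,7) unfolding compat_def has_lower_bound_def by (auto dest: transD)
  then show ?thesis
    using assms(2,4,6) unfolding complete_embedding_def by blast
qed

text \<open>
  Incompatibility is preserved only for pairs, so the members of \<open>X\<close> are met one at a time; this
  is where finiteness is needed.
\<close>

lemma lower_bound_below_reduction:
  assumes "finite X" "X \<subseteq> P"
    and "refl_on P leP" "trans leP" "trans leQ" "complete_embedding P leP Q leQ \<iota>"
    and "is_reduction P leP Q leQ \<iota> q r" "\<forall>x\<in>X. (q, \<iota> x) \<in> leQ"
  shows "\<exists>s\<in>P. (s, r) \<in> leP \<and> (\<forall>x\<in>X. (s, x) \<in> leP)"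
  using assms(1,2,8)
proof (induction X)
  case empty
  have "r \<in> P"
    using assms(7) unfolding is_reduction_def by blast
  then show ?case
    using assms(3) by (auto dest: refl_onD)
next
  case (insert x X)
  then obtain s where s: "s \<in> P" "(s, r) \<in> leP" "\<forall>y\<in>X. (s, y) \<in> leP"
    by auto
  have "compat P leP s x"
    using compat_below_reduction[OF assms(5,6,7) s(1,2)] insert.prems by auto
  then obtain t where "t \<in> P" "(t, s) \<in> leP" "(t, x) \<in> leP"
    unfolding compat_def has_lower_bound_def by auto
  then show ?case
    using s assms(4) by (auto dest: transD)
qed

lemma has_lower_bound_image_iff:
  assumes "forcing_notion P leP" "forcing_notion Q leQ" "complete_embedding P leP Q leQ \<iota>"
    and "finite X" "X \<subseteq> P"
  shows "has_lower_bound Q leQ (\<iota> ` X) \<longleftrightarrow> has_lower_bound P leP X"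
proof
  assume "has_lower_bound Q leQ (\<iota> ` X)"
  then obtain q where q: "q \<in> Q" "\<forall>x\<in>X. (q, \<iota> x) \<in> leQ"
    unfolding has_lower_bound_def by auto
  then obtain r where "is_reduction P leP Q leQ \<iota> q r"
    using assms(3) unfolding complete_embedding_def by blast
  moreover have "refl_on P leP" "trans leP" "trans leQ"
    using assms(1,2) unfolding forcing_notion_def preorder_on_def by auto
  ultimately show "has_lower_bound P leP X"
    using lower_bound_below_reduction[OF assms(4,5) _ _ _ assms(3)] q(2)
    unfolding has_lower_bound_def by blast
next
  assume "has_lower_bound P leP X"
  then obtain p where "p \<in> P" "\<forall>x\<in>X. (p, x) \<in> leP"
    unfolding has_lower_bound_def by blast
  then show "has_lower_bound Q leQ (\<iota> ` X)"
    using assms(3,5) unfolding complete_embedding_def has_lower_bound_def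
    by (intro bexI[of _ "\<iota> p"]) auto
qed

lemma i_star_complete_embedding:
  assumes "forcing_notion P leP" "forcing_notion Q leQ" "complete_embedding P leP Q leQ \<iota>"
    and "\<And>i. i < n \<Longrightarrow> p i \<in> P" "\<And>i. i < n \<Longrightarrow> q i = \<iota> (p i)"
  shows "i_star Q leQ n q = i_star P leP n p"
proof -
  have "has_lower_bound Q leQ (q ` F) \<longleftrightarrow> has_lower_bound P leP (p ` F)" if "F \<subseteq> {..<n}" for F
  proof -
    have "q ` F = \<iota> ` p ` F"
      using that assms(5) by (auto simp: image_image intro!: image_cong)
    moreover have "finite (p ` F)" "p ` F \<subseteq> P"
      using that assms(4) by (auto intro: finite_subset)
    ultimately show ?thesis
      using has_lower_bound_image_iff[OF assms(1-3)] by simp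
  qed
  then show ?thesis
    unfolding i_star_def by (intro arg_cong[where f = Max]) blast
qed

lemma intersection_number_complete_embedding:
  assumes "forcing_notion P leP" "forcing_notion Q leQ" "complete_embedding P leP Q leQ \<iota>"
    and "A \<subseteq> P"
  shows "intersection_number P leP A = intersection_number Q leQ (\<iota> ` A)"
  unfolding intersection_number_def
proof (intro arg_cong[where f = Inf] set_eqI iffI; clarsimp)
  fix n :: nat and p
  assume n: "0 < n" and p: "p \<in> {..<n} \<rightarrow>\<^sub>E A"
  have "i_star Q leQ n (\<lambda>i\<in>{..<n}. \<iota> (p i)) = i_star P leP n p"
    using p assms(4) by (intro i_star_complete_embedding[OF assms(1-3)]) auto
  moreover have "(\<lambda>i\<in>{..<n}. \<iota> (p i)) \<in> {..<n} \<rightarrow>\<^sub>E \<iota> ` A"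
    using p by auto
  ultimately show "\<exists>m q. real (i_star P leP n p) / real n = real (i_star Q leQ m q) / real m \<and>
      0 < m \<and> q \<in> {..<m} \<rightarrow>\<^sub>E \<iota> ` A"
    using n by metis
next
  fix n :: nat and q
  assume n: "0 < n" and q: "q \<in> {..<n} \<rightarrow>\<^sub>E \<iota> ` A"
  \<comment> \<open>The embedding may identify elements of \<open>A\<close>; any choice of preimages in \<open>A\<close> lifts the tuple.\<close>
  define p where "p = (\<lambda>i\<in>{..<n}. inv_into A \<iota> (q i))"
  have q_img: "q i \<in> \<iota> ` A" if "i < n" for i
    using q that by auto
  then have p: "p \<in> {..<n} \<rightarrow>\<^sub>E A"
    by (auto simp: p_def inv_into_into)
  have "i_star Q leQ n q = i_star P leP n p"
  proof (rule i_star_complete_embedding[OF assms(1-3)])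
    show "p i \<in> P" if "i < n" for i
      using p that assms(4) by auto
    show "q i = \<iota> (p i)" if "i < n" for i
      using q_img[OF that] that by (simp add: p_def f_inv_into_f)
  qed
  then show "\<exists>m p. real (i_star Q leQ n q) / real n = real (i_star P leP m p) / real m \<and>
      0 < m \<and> p \<in> {..<m} \<rightarrow>\<^sub>E A"
    using n p by metis
qed

lemma intersection_number_antimono:
  assumes "A \<subseteq> B"
  shows "intersection_number P le B \<le> intersection_number P le A"
proof -
  have "{..<n} \<rightarrow>\<^sub>E A \<subseteq> {..<n} \<rightarrow>\<^sub>E B" for n :: nat
    using assms by (intro PiE_mono) auto
  then show ?thesis
    unfolding intersection_number_def by (intro Inf_superset_mono) blast
qed

theorem corollary3p6:
  fixes P :: "'a set" and leP :: "'a rel"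
    and Q :: "'b set" and leQ :: "'b rel"
    and \<iota> :: "'a \<Rightarrow> 'b"
  assumes "forcing_notion P leP" and "forcing_notion Q leQ"
    and "complete_embedding P leP Q leQ \<iota>"
  shows "(\<forall>A. A \<subseteq> P \<longrightarrow>
            intersection_number P leP A = intersection_number Q leQ (\<iota> ` A)) \<and>
         (\<forall>R. R \<subseteq> Q \<longrightarrow>
            intersection_number Q leQ R \<le> intersection_number P leP (\<iota> -` R \<inter> P))"
proof (intro conjI allI impI)
  show eq: "intersection_number P leP A = intersection_number Q leQ (\<iota> ` A)" if "A \<subseteq> P" for A
    using assms that by (rule intersection_number_complete_embedding)
  show "intersection_number Q leQ R \<le> intersection_number P leP (\<iota> -` R \<inter> P)" for R
    by (subst eq) (auto intro: intersection_number_antimono)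
qed

end
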